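(* Let $d \ge 3$ be an integer, let $T_d$ be the $d$-regular tree, and let $T_d \Box \mathbb{Z}$ be the Cartesian product graph of $T_d$ and the line $\mathbb{Z}$. Then the critical probability for Bernoulli bond percolation on $T_d \Box \mathbb{Z}$ satisfies $$p_c(T_d \Box \mathbb{Z}) \le \frac{1}{d}.$$
   Context: $T_d$ is the infinite tree in which every vertex has degree $d$; $\mathbb{Z}$ denotes the graph on the integers with edges $\{k,k+1\}$. The Cartesian product $G_1\Box G_2$ has vertex set $V(G_1)\times V(G_2)$, with $(u,k)$ and $(v,l)$ adjacent iff ($u=v$ and $\{k,l\}\in E(G_2)$) or ($\{u,v\}\in E(G_1)$ and $k=l$). Bernoulli bond percolation with parameter $p\in[0,1]$ on an infinite, connected, locally finite graph $G=(V,E)$: each edge is independently open with probability $p$ and closed with probability $1-p$. Clusters are the connected components of the subgraph of open edges. The critical probability is $$p_c(G)=\inf\{p\in[0,1] \mid \text{there exists an infinite cluster almost surely}\}.$$ *)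

theory Defs
  imports "HOL-Probability.Probability"
begin

text \<open>
  Undirected graphs are pairs of a vertex set and a set of edges, an edge being the
  two-element set of its endpoints (enforced by \<open>simple_graph\<close>).
\<close>

type_synonym 'a ugraph = "'a set \<times> 'a set set"

abbreviation verts :: "'a ugraph \<Rightarrow> 'a set" where
  "verts G \<equiv> fst G"

abbreviation edges :: "'a ugraph \<Rightarrow> 'a set set" where
  "edges G \<equiv> snd G"

definition simple_graph :: "'a ugraph \<Rightarrow> bool" where
  "simple_graph G \<longleftrightarrow>
     (\<forall>e\<in>edges G. \<exists>u\<in>verts G. \<exists>v\<in>verts G. u \<noteq> v \<and> e = {u, v})"

definition degree :: "'a ugraph \<Rightarrow> 'a \<Rightarrow> nat" where
  "degree G v = card {e \<in> edges G. v \<in> e}"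

definition reachable :: "'a ugraph \<Rightarrow> 'a \<Rightarrow> 'a \<Rightarrow> bool" where
  "reachable G u v \<longleftrightarrow> (u, v) \<in> {(x, y). {x, y} \<in> edges G}\<^sup>*"

definition connected_graph :: "'a ugraph \<Rightarrow> bool" where
  "connected_graph G \<longleftrightarrow> verts G \<noteq> {} \<and> (\<forall>u\<in>verts G. \<forall>v\<in>verts G. reachable G u v)"

definition is_cycle :: "'a ugraph \<Rightarrow> 'a list \<Rightarrow> bool" where
  "is_cycle G vs \<longleftrightarrow> length vs \<ge> 3 \<and> distinct vs \<and>
     (\<forall>i < length vs. {vs ! i, vs ! (Suc i mod length vs)} \<in> edges G)"

definition tree :: "'a ugraph \<Rightarrow> bool" where
  "tree G \<longleftrightarrow> simple_graph G \<and> connected_graph G \<and> (\<nexists>vs. is_cycle G vs)"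

text \<open>
  The \<open>d\<close>-regular tree is determined only up to isomorphism; the predicate below
  characterises its representatives.
\<close>

definition regular_tree :: "nat \<Rightarrow> 'a ugraph \<Rightarrow> bool" where
  "regular_tree d G \<longleftrightarrow> tree G \<and> infinite (verts G) \<and> (\<forall>v\<in>verts G. degree G v = d)"

definition int_line :: "int ugraph" where
  "int_line = (UNIV, {{k, k + 1} |k. True})"

definition cartesian_product :: "'a ugraph \<Rightarrow> 'b ugraph \<Rightarrow> ('a \<times> 'b) ugraph"
    (infixr "\<box>" 75) where
  "G\<^sub>1 \<box> G\<^sub>2 =
     (verts G\<^sub>1 \<times> verts G\<^sub>2,
      {{(u, k), (v, l)} |u k v l.
         u \<in> verts G\<^sub>1 \<and> v \<in> verts G\<^sub>1 \<and> k \<in> verts G\<^sub>2 \<and> l \<in> verts G\<^sub>2 \<and>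
         (u = v \<and> {k, l} \<in> edges G\<^sub>2 \<or> {u, v} \<in> edges G\<^sub>1 \<and> k = l)})"

text \<open>
  A configuration maps each edge to \<open>True\<close> (open) or \<open>False\<close> (closed).
  Only \<open>p \<in> {0..1}\<close> is meaningful: \<^const>\<open>bernoulli_pmf\<close> clamps other values.
\<close>

definition bond_percolation :: "'a ugraph \<Rightarrow> real \<Rightarrow> ('a set \<Rightarrow> bool) measure" where
  "bond_percolation G p = PiM (edges G) (\<lambda>_. measure_pmf (bernoulli_pmf p))"

definition open_subgraph :: "'a ugraph \<Rightarrow> ('a set \<Rightarrow> bool) \<Rightarrow> 'a ugraph" where
  "open_subgraph G \<omega> = (verts G, {e \<in> edges G. \<omega> e})"

definition components_of_graph :: "'a ugraph \<Rightarrow> 'a set set" where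
  "components_of_graph G = (\<lambda>v. {w \<in> verts G. reachable G v w}) ` verts G"

definition clusters :: "'a ugraph \<Rightarrow> ('a set \<Rightarrow> bool) \<Rightarrow> 'a set set" where
  "clusters G \<omega> = components_of_graph (open_subgraph G \<omega>)"

definition critical_probability :: "'a ugraph \<Rightarrow> real" where
  "critical_probability G =
     Inf {p \<in> {0..1}. AE \<omega> in bond_percolation G p. \<exists>C\<in>clusters G \<omega>. infinite C}"

end

theory Submission imports Defs begin

text \<open>
  Root the tree so that every vertex has \<open>d - 1\<close> children, and explore the cluster of a vertex
  away from the root. On entering a line \<open>{u} \<times> \<int>\<close>, follow it in both directions until the first
  closed edge, giving a run of \<open>L\<close> vertices; a child of \<open>u\<close> is entered if at least one of the \<open>L\<close>
  edges leading to it is open. With \<open>q = 1 - p\<close> the mean number of entered children is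
  \<open>(d - 1) (1 - E q\<^sup>L) = (d - 1) (1 - q\<^sup>3 / (1 - p q)\<^sup>2)\<close>. At \<open>p = 1 / d\<close> this exceeds 1, as that
  amounts to \<open>d (d - 2)\<^sup>2 > 2\<close>. So the exploration is a supercritical branching process, and
  survives with probability at least some \<open>x > 0\<close>. Disjoint subtrees are independent, so the
  probability that none of the explorations started from the \<open>(d - 1)\<^sup>t\<close> vertices of generation \<open>t\<close>
  survives is at most \<open>(1 - x)\<close> to the power \<open>(d - 1)\<^sup>t\<close>, which tends to 0.
\<close>

subsection \<open>Embedding words into a regular tree\<close>

fun nonbacktracking :: "'a ugraph \<Rightarrow> 'a list \<Rightarrow> bool" where
  "nonbacktracking G (x # y # zs) \<longleftrightarrow>
     {x, y} \<in> edges G \<and> (zs \<noteq> [] \<longrightarrow> hd zs \<noteq> x) \<and> nonbacktracking G (y # zs)"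
| "nonbacktracking G _ \<longleftrightarrow> True"

lemma nonbacktracking_nth_edge:
  "nonbacktracking G xs \<Longrightarrow> Suc i < length xs \<Longrightarrow> {xs ! i, xs ! Suc i} \<in> edges G"
  by (induction G xs arbitrary: i rule: nonbacktracking.induct)
     (auto simp: nth_Cons split: nat.splits)

lemma nonbacktracking_nth_neq:
  "nonbacktracking G xs \<Longrightarrow> Suc (Suc i) < length xs \<Longrightarrow> xs ! i \<noteq> xs ! Suc (Suc i)"
proof (induction G xs arbitrary: i rule: nonbacktracking.induct)
  case (1 G x y zs)
  then show ?case by (cases i; cases zs) auto
qed auto

text \<open>Two equal entries at minimal distance \<delta> would bound a cycle: the entries from the
  first up to just before the second are distinct, and \<delta> is at least 3 because \<delta> = 1
  is a loop and \<delta> = 2 a backtrack.\<close>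

lemma nonbacktracking_distinct:
  assumes "tree G" and nb: "nonbacktracking G xs"
  shows "distinct xs"
proof (rule ccontr)
  define P where "P \<delta> \<longleftrightarrow> (\<exists>i. \<delta> > 0 \<and> i + \<delta> < length xs \<and> xs ! i = xs ! (i + \<delta>))" for \<delta>
  assume "\<not> distinct xs"
  then obtain i j where "i < j" "j < length xs" "xs ! i = xs ! j"
    unfolding distinct_conv_nth by (metis linorder_neqE_nat)
  then have "P (j - i)" unfolding P_def by (intro exI[of _ i]) auto
  define \<delta> where "\<delta> = (LEAST \<delta>. P \<delta>)"
  have P\<delta>: "P \<delta>" and least: "\<And>\<epsilon>. P \<epsilon> \<Longrightarrow> \<delta> \<le> \<epsilon>"
    unfolding \<delta>_def using \<open>P (j - i)\<close> by (auto intro: LeastI Least_le)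
  then obtain i where i: "\<delta> > 0" "i + \<delta> < length xs" "xs ! i = xs ! (i + \<delta>)"
    unfolding P_def by blast
  have "\<delta> \<noteq> 1"
  proof
    assume "\<delta> = 1"
    then have "{xs ! i, xs ! i} \<in> edges G"
      using nonbacktracking_nth_edge[OF nb, of i] i by simp
    then show False
      using \<open>tree G\<close> unfolding tree_def simple_graph_def by (metis doubleton_eq_iff)
  qed
  moreover have "\<delta> \<noteq> 2"
    using nonbacktracking_nth_neq[OF nb, of i] i by auto
  ultimately have "\<delta> \<ge> 3" using i by linarith
  let ?vs = "take \<delta> (drop i xs)"
  have len: "length ?vs = \<delta>" using i by simp
  have nth: "?vs ! t = xs ! (i + t)" if "t < \<delta>" for t using that i by simp
  have "distinct ?vs"
    unfolding distinct_conv_nth len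
  proof (intro allI impI notI)
    fix s t assume st: "s < \<delta>" "t < \<delta>" "s \<noteq> t" "?vs ! s = ?vs ! t"
    have "False" if "s < t" "t < \<delta>" "xs ! (i + s) = xs ! (i + t)" for s t
    proof -
      have "P (t - s)" unfolding P_def using that i by (intro exI[of _ "i + s"]) auto
      from least[OF this] that show False by linarith
    qed
    then show False using st nth by (metis linorder_neqE_nat)
  qed
  moreover have "{?vs ! t, ?vs ! (Suc t mod \<delta>)} \<in> edges G" if "t < \<delta>" for t
  proof (cases "Suc t < \<delta>")
    case True
    then show ?thesis using nonbacktracking_nth_edge[OF nb, of "i + t"] nth i by simp
  next
    case False
    then have "Suc t = \<delta>" using that by simp
    \<comment> \<open>The closing edge of the cycle: the successor of the last entry is
      \<open>xs ! (i + \<delta>)\<close>, which equals the first entry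
      \<open>xs ! i\<close>.\<close>
    then show ?thesis
      using nonbacktracking_nth_edge[OF nb, of "i + t"] nth[of t] nth[of 0] i
      by (simp flip: \<open>Suc t = \<delta>\<close>)
  qed
  ultimately have "is_cycle G ?vs"
    unfolding is_cycle_def len using \<open>\<delta> \<ge> 3\<close> by blast
  then show False using \<open>tree G\<close> unfolding tree_def by blast
qed

text \<open>The walks overlap in an edge, not just in a vertex. So any three consecutive vertices of
  the result lie within one of the two walks, up to reversal, and no new backtrack arises.\<close>

lemma nonbacktracking_glue:
  "nonbacktracking G (b # a # r) \<Longrightarrow> nonbacktracking G (a # b # s) \<Longrightarrow>
     nonbacktracking G (rev r @ a # b # s)"
proof (induction r arbitrary: a b s)
  case (Cons c r)
  then have "nonbacktracking G (rev r @ c # a # b # s)"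
    by (intro Cons.IH) (auto simp: insert_commute)
  then show ?case by simp
qed simp

text \<open>If the walks part after a common vertex, reversing one and appending the other gives a
  non-backtracking walk through that vertex. Its entries are distinct, yet the common last vertex
  occurs on both sides.\<close>

lemma nonbacktracking_unique:
  assumes "tree G"
  shows "nonbacktracking G xs \<Longrightarrow> nonbacktracking G ys \<Longrightarrow> xs \<noteq> [] \<Longrightarrow> ys \<noteq> [] \<Longrightarrow>
     hd xs = hd ys \<Longrightarrow> last xs = last ys \<Longrightarrow> xs = ys"
proof (induction xs arbitrary: ys)
  case (Cons x r ys)
  then obtain r' where ys: "ys = x # r'" by (cases ys) auto
  have dist: "distinct (x # r)" "distinct (x # r')"
    using Cons.prems ys by (auto intro!: nonbacktracking_distinct[OF \<open>tree G\<close>] simp del: distinct.simps)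
  show ?case
  proof (cases "r = [] \<or> r' = []")
    case True
    \<comment> \<open>When one walk is a single vertex, the other would return to its start, which
      distinctness forbids.\<close>
    then have "r = []" "r' = []"
      using dist Cons.prems ys last_in_set[of r] last_in_set[of r'] by (auto split: if_splits)
    then show ?thesis using ys by simp
  next
    case False
    then obtain y s y' s' where r: "r = y # s" and r': "r' = y' # s'"
      by (auto simp: neq_Nil_conv)
    show ?thesis
    proof (cases "y = y'")
      case True
      then have "r = r'" using Cons.prems ys r r' by (intro Cons.IH) auto
      then show ?thesis using ys by simp
    next
      case False
      have "nonbacktracking G (rev s @ y # x # y' # s')"
        using Cons.prems ys r r' False
        by (intro nonbacktracking_glue) (auto simp: insert_commute)
      then have "distinct (rev s @ y # x # y' # s')"
        by (rule nonbacktracking_distinct[OF \<open>tree G\<close>])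
      then have "set (y # s) \<inter> set (y' # s') = {}" by auto
      moreover have "last (y # s) = last (y' # s')" using Cons.prems ys r r' by simp
      ultimately show ?thesis using last_in_set[of "y # s"] last_in_set[of "y' # s'"] by force
    qed
  qed
qed simp

section \<open>The tree of words inside the regular tree\<close>

definition neighbours :: "'a ugraph \<Rightarrow> 'a \<Rightarrow> 'a set" where
  "neighbours G u = {x. {u, x} \<in> edges G}"

lemma card_neighbours:
  assumes "simple_graph G"
  shows "card (neighbours G u) = degree G u"
proof -
  have "inj_on (\<lambda>x. {u, x}) (neighbours G u)"
    by (auto simp: inj_on_def doubleton_eq_iff)
  moreover have "(\<lambda>x. {u, x}) ` neighbours G u = {e \<in> edges G. u \<in> e}"
  proof (intro equalityI subsetI)
    fix e assume "e \<in> {e \<in> edges G. u \<in> e}"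
    moreover from this obtain x y where "e = {x, y}"
      using assms unfolding simple_graph_def by blast
    ultimately show "e \<in> (\<lambda>x. {u, x}) ` neighbours G u"
      by (auto simp: neighbours_def insert_commute)
  qed (auto simp: neighbours_def)
  ultimately show ?thesis unfolding degree_def by (metis card_image)
qed

lemma neighbours_subset_verts:
  "simple_graph G \<Longrightarrow> neighbours G u \<subseteq> verts G"
  unfolding neighbours_def simple_graph_def by (auto simp: doubleton_eq_iff dest!: bspec)

text \<open>
  Words over \<open>{..<d - 1}\<close> address the vertices of \<open>T\<close>, with \<open>i # w\<close> a child of \<open>w\<close>;
  \<open>walk_to\<close> lists the images of the suffixes of \<open>w\<close> and ends in an artificial parent of the root,
  so that the root also has just \<open>d - 1\<close> children.
\<close>

primrec walk_to :: "'a ugraph \<Rightarrow> 'a \<Rightarrow> 'a \<Rightarrow> nat list \<Rightarrow> 'a list" where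
  "walk_to G r r' [] = [r, r']"
| "walk_to G r r' (i # w) =
     (let vs = walk_to G r r' w
      in from_nat_into (neighbours G (vs ! 0) - {vs ! 1}) i # vs)"

text \<open>A word is mapped to the head of its walk. All walks end in \<open>r'\<close>, so equal
  heads force equal walks by uniqueness of non-backtracking walks, and a walk determines the child
  chosen at each letter. The words cover only a subtree, which is enough for finding an infinite
  cluster.\<close>

lemma regular_tree_word_embedding:
  assumes "regular_tree d G" and "d > 0"
  obtains v :: "nat list \<Rightarrow> 'a" where
    "\<And>w. w \<in> lists {..<d - 1} \<Longrightarrow> v w \<in> verts G"
    "inj_on v (lists {..<d - 1})"
    "\<And>i w. i < d - 1 \<Longrightarrow> w \<in> lists {..<d - 1} \<Longrightarrow> {v w, v (i # w)} \<in> edges G"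
proof -
  have tree: "tree G" and simple: "simple_graph G"
    using assms unfolding regular_tree_def tree_def by auto
  have card: "card (neighbours G u) = d" if "u \<in> verts G" for u
    using card_neighbours[OF simple] assms that unfolding regular_tree_def by auto
  have fin: "finite (neighbours G u)" if "u \<in> verts G" for u
    using card[OF that] \<open>d > 0\<close> card_gt_0_iff by metis
  obtain r where r: "r \<in> verts G"
    using assms unfolding regular_tree_def by fastforce
  obtain r' where r': "r' \<in> neighbours G r"
    using card[OF r] \<open>d > 0\<close> by fastforce
  define W where "W = walk_to G r r'"
  \<comment> \<open>The children of the vertex addressed by \<open>w\<close>: its neighbours other
    than the next vertex on the walk. There are \<open>d - 1\<close> of them, numbered by
    \<open>from_nat_into\<close>.\<close>
  define C where "C w = neighbours G (W w ! 0) - {W w ! 1}" for w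
  have W_Nil: "W [] = [r, r']" and W_Cons: "\<And>i w. W (i # w) = from_nat_into (C w) i # W w"
    by (simp_all add: W_def C_def Let_def)
  have W_shape: "\<exists>x y zs. W w = x # y # zs \<and> x \<in> verts G \<and> y \<in> neighbours G x \<and>
      nonbacktracking G (W w) \<and> last (W w) = r' \<and>
      bij_betw (from_nat_into (C w)) {..<d - 1} (C w)" if "w \<in> lists {..<d - 1}" for w
    using that
  proof (induction w)
    case Nil
    have "card (C []) = d - 1" "finite (C [])"
      using card[OF r] r' fin[OF r] by (auto simp: C_def W_Nil)
    then show ?case
      using bij_betw_from_nat_into_finite[of "C []"] r r' by (auto simp: W_Nil neighbours_def)
  next
    case (Cons i w)
    then obtain x y zs where IH: "W w = x # y # zs" "x \<in> verts G" "y \<in> neighbours G x"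
      "nonbacktracking G (W w)" "last (W w) = r'"
      "bij_betw (from_nat_into (C w)) {..<d - 1} (C w)" by blast
    let ?c = "from_nat_into (C w) i"
    have c: "?c \<in> C w" using bij_betwE[OF IH(6)] Cons.hyps by blast
    then have "?c \<in> neighbours G x" "?c \<noteq> y" by (auto simp: C_def IH(1))
    then have x: "x \<in> neighbours G ?c" by (simp add: neighbours_def insert_commute)
    have cV: "?c \<in> verts G"
      using \<open>?c \<in> neighbours G x\<close> neighbours_subset_verts[OF simple] by blast
    have "C (i # w) = neighbours G ?c - {x}" by (simp add: C_def W_Cons IH(1))
    then have "card (C (i # w)) = d - 1" "finite (C (i # w))"
      using card[OF cV] x fin[OF cV] by auto
    then have "bij_betw (from_nat_into (C (i # w))) {..<d - 1} (C (i # w))"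
      using bij_betw_from_nat_into_finite[of "C (i # w)"] by simp
    then show ?case
      using IH x cV \<open>?c \<noteq> y\<close> by (auto simp: W_Cons neighbours_def)
  qed
  have len: "length (W w) = length w + 2" for w by (induction w) (auto simp: W_Nil W_Cons)
  have inj: "W w = W w' \<Longrightarrow> w = w'"
    if "w \<in> lists {..<d - 1}" "w' \<in> lists {..<d - 1}" for w w'
    using that
  proof (induction w arbitrary: w')
    case Nil
    then have "length w' = 0" using len[of "[]"] len[of w'] by (metis add_right_cancel list.size(3))
    then show ?case by simp
  next
    case (Cons i w w')
    have "length w' = length (i # w)"
      using len[of "i # w"] len[of w'] Cons.prems(1) by (metis add_right_cancel)
    then obtain j u where w': "w' = j # u" by (cases w') auto
    have *: "from_nat_into (C w) i = from_nat_into (C u) j" "W w = W u"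
      using Cons.prems by (auto simp: w' W_Cons)
    then have "w = u" using Cons.IH[of u] Cons.prems w' Cons.hyps by auto
    moreover have "inj_on (from_nat_into (C w)) {..<d - 1}"
      using W_shape[of w] Cons.hyps by (auto dest: bij_betw_imp_inj_on)
    ultimately show ?case
      using * Cons.hyps Cons.prems w' by (auto dest: inj_onD)
  qed
  show thesis
  proof
    fix w assume "w \<in> lists {..<d - 1}"
    from W_shape[OF this] show "W w ! 0 \<in> verts G" by auto
  next
    show "inj_on (\<lambda>w. W w ! 0) (lists {..<d - 1})"
    proof (rule inj_onI)
      fix w w' assume ww: "w \<in> lists {..<d - 1}" "w' \<in> lists {..<d - 1}" "W w ! 0 = W w' ! 0"
      have "W w = W w'"
        using W_shape[OF ww(1)] W_shape[OF ww(2)] ww(3)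
        by (intro nonbacktracking_unique[OF tree]) auto
      then show "w = w'" using inj ww by blast
    qed
  next
    fix i w assume "i < d - 1" and w: "w \<in> lists {..<d - 1}"
    then have "W (i # w) ! 0 \<in> C w"
      using W_shape[OF w] by (auto simp: W_Cons dest: bij_betwE)
    then show "{W w ! 0, W (i # w) ! 0} \<in> edges G"
      by (auto simp: C_def neighbours_def)
  qed
qed

subsection \<open>The exploration process\<close>

text \<open>
  \<open>Line w k\<close> joins \<open>(w, k)\<close> to \<open>(w, k + 1)\<close>, and \<open>Rung w k\<close> joins \<open>(w, k)\<close> to \<open>(tl w, k)\<close>.
\<close>

datatype bond = Line "nat list" int | Rung "nat list" int

definition bonds :: "nat \<Rightarrow> bond set" where
  "bonds m = {Line w k | w k. w \<in> lists {..<m}} \<union> {Rung w k | w k. w \<in> lists {..<m} \<and> w \<noteq> []}"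

text \<open>The words \<open>u @ w\<close> address \<open>w\<close> and its descendants. The case
  \<open>u = []\<close> includes the rungs from the line of \<open>w\<close> to that of its
  parent.\<close>

definition branch :: "nat \<Rightarrow> nat list \<Rightarrow> bond set" where
  "branch m w = {Line (u @ w) k | u k. u \<in> lists {..<m}} \<union> {Rung (u @ w) k | u k. u \<in> lists {..<m}}"

text \<open>\<open>branch m w\<close> without the rungs leading to the parent. Leaving these out
  makes an entrance rung independent of the survival beyond it.\<close>

definition below :: "nat \<Rightarrow> nat list \<Rightarrow> bond set" where
  "below m w = range (Line w) \<union> (\<Union>i<m. branch m (i # w))"

lemma branch_subset_bonds: "w \<in> lists {..<m} \<Longrightarrow> w \<noteq> [] \<Longrightarrow> branch m w \<subseteq> bonds m"
  by (auto simp: branch_def bonds_def)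

lemma range_Line_subset_bonds: "w \<in> lists {..<m} \<Longrightarrow> range (Line w) \<subseteq> bonds m"
  by (auto simp: bonds_def)

lemma below_subset_bonds: "w \<in> lists {..<m} \<Longrightarrow> below m w \<subseteq> bonds m"
  unfolding below_def
  by (intro Un_least UN_least range_Line_subset_bonds branch_subset_bonds) auto

lemma branch_Cons_subset_branch: "i < m \<Longrightarrow> branch m (i # w) \<subseteq> branch m w"
proof -
  assume i: "i < m"
  have "\<exists>u'. u' \<in> lists {..<m} \<and> u @ i # w = u' @ w" if "u \<in> lists {..<m}" for u
    using i that by (intro exI[of _ "u @ [i]"]) auto
  then show ?thesis unfolding branch_def by (auto; blast)
qed

lemma below_subset_branch: "below m w \<subseteq> branch m w"
proof -
  have "range (Line w) \<subseteq> branch m w" unfolding branch_def by force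
  then show ?thesis
    unfolding below_def by (intro Un_least UN_least branch_Cons_subset_branch) auto
qed

lemma range_Rung_subset_branch: "range (Rung w) \<subseteq> branch m w"
  by (force simp: branch_def)

lemma Rung_notin_below: "Rung w k \<notin> below m w"
  by (auto simp: below_def branch_def)

text \<open>Addresses are read from the right: the letter in front of the suffix \<open>w\<close>
  names the child. This makes the branches of siblings disjoint.\<close>

lemma branch_Cons_eqD: "b \<in> branch m (i # w) \<Longrightarrow> b \<in> branch m (j # w) \<Longrightarrow> i = j"
proof -
  assume "b \<in> branch m (i # w)" "b \<in> branch m (j # w)"
  then obtain u u' where "(u @ [i]) @ w = (u' @ [j]) @ w"
    by (auto simp: branch_def)
  then show "i = j" by (simp only: append_same_eq) simp
qed

lemma Line_notin_branch: "Line w k \<notin> branch m (i # w)"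
  by (auto simp: branch_def)

text \<open>Keeps of the percolation measure only that the bond events are independent with common
  probability \<open>p\<close>. Here \<open>m\<close> is the number of children of a word and
  \<open>r\<close> the truncation of runs.\<close>

locale bond_events = prob_space M for M :: "'w measure" +
  fixes m r :: nat and p :: real and X :: "bond \<Rightarrow> 'w set"
  assumes indep: "indep_events X (bonds m)"
    and prob_X: "b \<in> bonds m \<Longrightarrow> prob (X b) = p"
    and p_bounds: "0 \<le> p" "p \<le> 1"
    and m_pos: "0 < m"
begin

section \<open>Events depending only on the bonds in a given set\<close>

definition sg :: "bond set \<Rightarrow> 'w set set" where
  "sg K = sigma_sets (space M) (X ` K)"

lemma X_events: "b \<in> bonds m \<Longrightarrow> X b \<in> events"
  using indep by (auto simp: indep_events_def)

lemma sg_subset_events: "K \<subseteq> bonds m \<Longrightarrow> sg K \<subseteq> events"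
  unfolding sg_def using X_events by (intro sets.sigma_sets_subset) auto

lemma sg_mono: "A \<in> sg K \<Longrightarrow> K \<subseteq> L \<Longrightarrow> A \<in> sg L"
  unfolding sg_def using sigma_sets_mono'[of "X ` K" "X ` L"] by auto

lemma X_in_sg: "b \<in> K \<Longrightarrow> X b \<in> sg K"
  unfolding sg_def by (auto intro: sigma_sets.Basic)

lemma sigma_algebra_sg: "K \<subseteq> bonds m \<Longrightarrow> sigma_algebra (space M) (sg K)"
  unfolding sg_def using X_events sets.sets_into_space
  by (intro sigma_algebra_sigma_sets) blast

text \<open>Disjoint blocks of an independent family generate independent sigma-algebras; the
  generators \<open>{X b}\<close> are trivially stable under intersection.\<close>

lemma indep_sets_sg:
  assumes "disjoint_family_on K J" "\<And>j. j \<in> J \<Longrightarrow> K j \<subseteq> bonds m"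
  shows "indep_sets (\<lambda>j. sg (K j)) J"
proof -
  have "indep_sets (\<lambda>b. {X b}) (\<Union>j\<in>J. K j)"
    using assms(2) by (intro indep_sets_mono_index[OF _ indep[unfolded indep_events_def_alt]]) auto
  from indep_sets_collect_sigma[OF this _ assms(1)]
  have "indep_sets (\<lambda>j. sigma_sets (space M) (\<Union>b\<in>K j. {X b})) J"
    by (auto simp: Int_stable_def)
  then show ?thesis by (simp add: sg_def UNION_singleton_eq_range)
qed

lemma prob_Int_sg:
  assumes "A \<in> sg K" "B \<in> sg L" "K \<inter> L = {}" "K \<subseteq> bonds m" "L \<subseteq> bonds m"
  shows "prob (A \<inter> B) = prob A * prob B"
proof -
  have "indep_sets (\<lambda>j. sg (case_bool K L j)) UNIV"
    using assms by (intro indep_sets_sg) (auto simp: disjoint_family_on_def split: bool.splits)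
  from indep_setsD[OF this, of UNIV "case_bool A B"] show ?thesis
    using assms by (simp add: UNIV_bool ac_simps)
qed

section \<open>Finite patterns of bonds and runs on a line\<close>

definition pattern :: "bond set \<Rightarrow> bond set \<Rightarrow> 'w set" where
  "pattern P N = {\<omega> \<in> space M. (\<forall>b\<in>P. \<omega> \<in> X b) \<and> (\<forall>b\<in>N. \<omega> \<notin> X b)}"

lemma pattern_in_sg:
  assumes "finite P" "finite N" "P \<union> N \<subseteq> K" "K \<subseteq> bonds m"
  shows "pattern P N \<in> sg K"
proof -
  interpret S: sigma_algebra "space M" "sg K" by (rule sigma_algebra_sg) fact
  have mem: "{\<omega> \<in> space M. \<omega> \<in> X b} \<in> sg K" if "b \<in> K" for b
  proof -
    have "{\<omega> \<in> space M. \<omega> \<in> X b} = X b"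
      using X_in_sg[OF that] S.sets_into_space by blast
    then show ?thesis using X_in_sg[OF that] by simp
  qed
  show ?thesis
    unfolding pattern_def using assms mem
    by (intro S.sets_Collect_conj S.sets_Collect_finite_All S.sets_Collect_neg) auto
qed

lemma prob_pattern:
  assumes "finite P" "finite N" "P \<inter> N = {}" "P \<union> N \<subseteq> bonds m"
  shows "prob (pattern P N) = p ^ card P * (1 - p) ^ card N"
  using assms
proof (induction P rule: finite_induct)
  case empty
  from empty(1,3) show ?case
  proof (induction N rule: finite_induct)
    case empty
    then show ?case by (simp add: pattern_def prob_space)
  next
    case (insert b N)
    have "pattern {} (insert b N) = (space M - X b) \<inter> pattern {} N"
      by (auto simp: pattern_def)
    also have "prob \<dots> = prob (space M - X b) * prob (pattern {} N)"
    proof (rule prob_Int_sg)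
      interpret S: sigma_algebra "space M" "sg {b}" using insert by (intro sigma_algebra_sg) auto
      show "space M - X b \<in> sg {b}" using X_in_sg[of b "{b}"] by auto
      show "pattern {} N \<in> sg N" using insert by (intro pattern_in_sg) auto
    qed (use insert in auto)
    also have "prob (space M - X b) = 1 - p"
      using insert X_events prob_X by (simp add: prob_compl)
    finally show ?case using insert by simp
  qed
next
  case (insert b P)
  have "pattern (insert b P) N = X b \<inter> pattern P N"
    by (auto simp: pattern_def)
  also have "prob \<dots> = prob (X b) * prob (pattern P N)"
  proof (rule prob_Int_sg)
    show "X b \<in> sg {b}" by (rule X_in_sg) simp
    show "pattern P N \<in> sg (P \<union> N)" using insert by (intro pattern_in_sg) auto
  qed (use insert in auto)
  also have "prob (X b) = p" using insert prob_X by auto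
  finally show ?case using insert by simp
qed

text \<open>The open cluster of \<open>k\<close> within its line reaches exactly from
  \<open>k - a\<close> to \<open>k + b\<close>: \<open>a + b\<close> open bonds, one closed bond at
  either end, and \<open>a + b + 1\<close> vertices.\<close>

definition run :: "nat list \<Rightarrow> int \<Rightarrow> nat \<Rightarrow> nat \<Rightarrow> 'w set" where
  "run w k a b = pattern (Line w ` {k - int a..<k + int b}) {Line w (k - int a - 1), Line w (k + int b)}"

lemma run_in_sg: "w \<in> lists {..<m} \<Longrightarrow> run w k a b \<in> sg (range (Line w))"
  unfolding run_def by (rule pattern_in_sg) (auto simp: bonds_def)

lemma prob_run:
  assumes "w \<in> lists {..<m}"
  shows "prob (run w k a b) = p ^ (a + b) * (1 - p)\<^sup>2"
proof -
  have "card (Line w ` {k - int a..<k + int b}) = a + b"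
    by (subst card_image) (auto simp: inj_on_def nat_add_distrib)
  moreover have "card {Line w (k - int a - 1), Line w (k + int b)} = 2" by simp
  moreover have "prob (run w k a b) = p ^ card (Line w ` {k - int a..<k + int b}) *
      (1 - p) ^ card {Line w (k - int a - 1), Line w (k + int b)}"
    unfolding run_def using assms by (intro prob_pattern) (auto simp: bonds_def)
  ultimately show ?thesis by (simp only:)
qed

text \<open>If one interval stuck out of the other, a closed bond bounding the latter would be open
  in the former.\<close>

lemma run_unique:
  assumes "\<omega> \<in> run w k a b" "\<omega> \<in> run w k a' b'"
  shows "a = a' \<and> b = b'"
proof -
  have *: "a \<le> a' \<and> b \<le> b'" if "\<omega> \<in> run w k a b" "\<omega> \<in> run w k a' b'" for a b a' b'
  proof (rule ccontr)
    assume "\<not> ?thesis"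
    then have "k - int a' - 1 \<in> {k - int a..<k + int b} \<or> k + int b' \<in> {k - int a..<k + int b}"
      by auto
    then show False using that by (auto simp: run_def pattern_def)
  qed
  show ?thesis using *[of a b a' b'] *[of a' b' a b] assms by auto
qed

section \<open>From one line to the lines of its children\<close>

lemma prob_some_rung:
  assumes c: "c \<in> lists {..<m}" "c \<noteq> []"
    and A: "\<And>j. A j \<in> sg (below m c)" "\<And>j. x \<le> prob (A j)" and "0 \<le> x"
  shows "(1 - (1 - p) ^ N) * x \<le> prob (\<Union>t<N. X (Rung c (l + int t)) \<inter> A (l + int t))"
proof (induction N arbitrary: l)
  case 0
  show ?case by simp
next
  case (Suc N)
  \<comment> \<open>\<open>?K (l + 1)\<close> omits \<open>Rung c l\<close>, so the lowest rung is
    independent of the attempts at greater heights. The induction looks at this rung first: if it is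
    open, \<open>A l\<close> is the attempt that counts; if it is closed, the remaining
    \<open>N\<close> rungs are tried. The events \<open>A j\<close> may depend on each
    other.\<close>
  let ?K = "\<lambda>l. below m c \<union> Rung c ` {l..}"
  let ?U = "\<lambda>(N::nat) l. \<Union>t<N. X (Rung c (l + int t)) \<inter> A (l + int t)"
  have K: "?K l \<subseteq> bonds m" for l using below_subset_bonds c by (auto simp: bonds_def)
  have U: "?U N l \<in> sg (?K l)" for N and l :: int
  proof -
    interpret S: sigma_algebra "space M" "sg (?K l)" by (rule sigma_algebra_sg) (rule K)
    show ?thesis
      by (intro S.finite_UN S.Int X_in_sg sg_mono[OF A(1)]) auto
  qed
  have ev: "?U N l \<in> events" for N l using U sg_subset_events[OF K] by blast
  have evX: "X (Rung c l) \<in> events" using c by (intro X_events) (auto simp: bonds_def)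
  have evA: "A l \<in> events" using A(1) below_subset_bonds[OF c(1)] sg_subset_events by blast
  have 1: "prob (X (Rung c l) \<inter> A l) = p * prob (A l)"
  proof -
    have "prob (X (Rung c l) \<inter> A l) = prob (X (Rung c l)) * prob (A l)"
      using A(1) c below_subset_bonds[OF c(1)]
      by (intro prob_Int_sg[of _ "{Rung c l}" _ "below m c"] X_in_sg) (auto simp: bonds_def Rung_notin_below)
    then show ?thesis using c by (subst (asm) prob_X) (auto simp: bonds_def)
  qed
  have 2: "prob ((space M - X (Rung c l)) \<inter> ?U N (l + 1)) = (1 - p) * prob (?U N (l + 1))"
  proof -
    have "Rung c l \<in> bonds m" using c by (auto simp: bonds_def)
    then interpret S: sigma_algebra "space M" "sg {Rung c l}" by (intro sigma_algebra_sg) auto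
    have "prob ((space M - X (Rung c l)) \<inter> ?U N (l + 1)) =
        prob (space M - X (Rung c l)) * prob (?U N (l + 1))"
      using U[of "l + 1" N] K[of "l + 1"] \<open>Rung c l \<in> bonds m\<close>
      by (intro prob_Int_sg[of _ "{Rung c l}" _ "?K (l + 1)"] S.compl_sets X_in_sg)
         (auto simp: Rung_notin_below)
    also have "prob (space M - X (Rung c l)) = 1 - p"
      using evX prob_X \<open>Rung c l \<in> bonds m\<close> by (simp add: prob_compl)
    finally show ?thesis .
  qed
  have "(1 - (1 - p) ^ Suc N) * x = p * x + (1 - p) * ((1 - (1 - p) ^ N) * x)"
    by (simp add: algebra_simps)
  also have "\<dots> \<le> p * prob (A l) + (1 - p) * prob (?U N (l + 1))"
    using Suc.IH[of "l + 1"] A(2)[of l] p_bounds by (intro add_mono mult_left_mono) auto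
  also have "\<dots> = prob ((X (Rung c l) \<inter> A l) \<union> ((space M - X (Rung c l)) \<inter> ?U N (l + 1)))"
    using 1 2 evX evA ev by (subst finite_measure_Union) auto
  also have "\<dots> \<le> prob (?U (Suc N) l)"
  proof (rule finite_measure_mono)
    have "?U N (l + 1) \<subseteq> ?U (Suc N) l"
    proof
      fix \<omega> assume "\<omega> \<in> ?U N (l + 1)"
      then obtain t where "t < N" "\<omega> \<in> X (Rung c (l + 1 + int t)) \<inter> A (l + 1 + int t)" by blast
      then show "\<omega> \<in> ?U (Suc N) l" by (intro UN_I[of "Suc t"]) (auto simp: algebra_simps)
    qed
    moreover have "X (Rung c l) \<inter> A l \<subseteq> ?U (Suc N) l" by (force intro!: UN_I[of 0])
    ultimately show "(X (Rung c l) \<inter> A l) \<union> ((space M - X (Rung c l)) \<inter> ?U N (l + 1)) \<subseteq> ?U (Suc N) l"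
      by blast
  qed (rule ev)
  finally show ?case .
qed

text \<open>Siblings have disjoint branches, so their failures are independent and the probability
  that all fail is a product of \<open>m\<close> factors, each at most \<open>1 - y\<close>.\<close>

lemma prob_some_child:
  assumes w: "w \<in> lists {..<m}"
    and H: "\<And>i. i < m \<Longrightarrow> H i \<in> sg (branch m (i # w))" "\<And>i. i < m \<Longrightarrow> y \<le> prob (H i)"
  shows "1 - (1 - y) ^ m \<le> prob (\<Union>i<m. H i)"
proof -
  have sub: "branch m (i # w) \<subseteq> bonds m" if "i < m" for i
    using that w by (intro branch_subset_bonds) auto
  have ev: "H i \<in> events" if "i < m" for i using H(1) sub sg_subset_events that by blast
  have "indep_sets (\<lambda>i. sg (branch m (i # w))) {..<m}"
    using sub branch_Cons_eqD by (intro indep_sets_sg) (auto simp: disjoint_family_on_def)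
  moreover have "\<forall>i\<in>{..<m}. space M - H i \<in> sg (branch m (i # w))"
    using H(1) sub sigma_algebra_sg unfolding sigma_algebra_iff2 by blast
  ultimately have "prob (\<Inter>i<m. space M - H i) = (\<Prod>i<m. prob (space M - H i))"
    using m_pos by (intro indep_setsD) auto
  also have "\<dots> \<le> (\<Prod>i<m. 1 - y)"
    using H(2) ev by (intro prod_mono) (auto simp: prob_compl)
  also have "(\<Inter>i<m. space M - H i) = space M - (\<Union>i<m. H i)"
    using m_pos by auto
  also have "prob \<dots> = 1 - prob (\<Union>i<m. H i)"
    using ev by (intro prob_compl) auto
  finally show ?thesis by simp
qed

text \<open>
  Only runs reaching less than \<open>r\<close> steps in each direction are used; \<open>r\<close> is chosen so large that
  the truncated branching process is still supercritical.
\<close>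

primrec survive :: "nat \<Rightarrow> nat list \<Rightarrow> int \<Rightarrow> 'w set" where
  "survive 0 w k = space M"
| "survive (Suc n) w k =
     (\<Union>(a, b)\<in>{..<r} \<times> {..<r}. run w k a b \<inter>
       (\<Union>i<m. \<Union>t<a + b + 1. X (Rung (i # w) (k - int a + int t)) \<inter> survive n (i # w) (k - int a + int t)))"

lemma rungs_in_sg:
  assumes "w \<in> lists {..<m}" "i < m" "\<And>j. A j \<in> sg (below m (i # w))"
  shows "(\<Union>t<(N::nat). X (Rung (i # w) (l + int t)) \<inter> A (l + int t)) \<in> sg (branch m (i # w))"
proof -
  interpret S: sigma_algebra "space M" "sg (branch m (i # w))"
    using assms by (intro sigma_algebra_sg branch_subset_bonds) auto
  have "Rung (i # w) k \<in> branch m (i # w)" for k using range_Rung_subset_branch by blast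
  then show ?thesis
    by (intro S.finite_UN S.Int X_in_sg sg_mono[OF assms(3) below_subset_branch]) auto
qed

lemma children_in_sg:
  assumes "w \<in> lists {..<m}" "\<And>i. i < m \<Longrightarrow> H i \<in> sg (branch m (i # w))"
  shows "(\<Union>i<m. H i) \<in> sg (\<Union>i<m. branch m (i # w))"
proof -
  interpret S: sigma_algebra "space M" "sg (\<Union>i<m. branch m (i # w))"
    using assms below_subset_bonds[of w m] by (intro sigma_algebra_sg) (auto simp: below_def)
  show ?thesis by (intro S.finite_UN) (auto intro!: sg_mono[OF assms(2)])
qed

text \<open>The exploration inspects the line of \<open>w\<close> and the branches of its children,
  never the rungs back to the parent.\<close>

lemma survive_in_sg: "w \<in> lists {..<m} \<Longrightarrow> survive n w k \<in> sg (below m w)"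
proof (induction n arbitrary: w k)
  case 0
  then interpret S: sigma_algebra "space M" "sg (below m w)"
    by (intro sigma_algebra_sg below_subset_bonds)
  show ?case by simp
next
  case (Suc n)
  then interpret S: sigma_algebra "space M" "sg (below m w)"
    by (intro sigma_algebra_sg below_subset_bonds)
  have "(\<Union>i<m. \<Union>t<a + b + 1. X (Rung (i # w) (k - int a + int t)) \<inter>
      survive n (i # w) (k - int a + int t)) \<in> sg (below m w)" for a b :: nat
    by (rule sg_mono[OF children_in_sg[OF Suc.prems]], rule rungs_in_sg)
       (use Suc in \<open>auto simp: below_def\<close>)
  moreover have "run w k a b \<in> sg (below m w)" for a b
    by (rule sg_mono[OF run_in_sg]) (use Suc in \<open>auto simp: below_def\<close>)
  ultimately show ?case
    unfolding survive.simps by (intro S.finite_UN) auto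
qed

text \<open>One generation of the branching recursion. The run depends only on the line of
  \<open>w\<close> and is independent of the children's branches. Given a run with
  \<open>a + b + 1\<close> vertices, \<open>prob_some_rung\<close> bounds the chance of each child
  and \<open>prob_some_child\<close> combines the children.\<close>

lemma prob_survive_Suc:
  assumes w: "w \<in> lists {..<m}" and "0 \<le> x"
    and IH: "\<And>i j. i < m \<Longrightarrow> x \<le> prob (survive n (i # w) j)"
  shows "(\<Sum>(a, b)\<in>{..<r} \<times> {..<r}. p ^ (a + b) * (1 - p)\<^sup>2 * (1 - (1 - (1 - (1 - p) ^ (a + b + 1)) * x) ^ m))
    \<le> prob (survive (Suc n) w k)"
proof -
  define H where "H = (\<lambda>(a::nat, b::nat) i. \<Union>t<a + b + 1. X (Rung (i # w) (k - int a + int t)) \<inter>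
      survive n (i # w) (k - int a + int t))"
  have Hsg: "H ab i \<in> sg (branch m (i # w))" if "i < m" for ab i
    unfolding H_def case_prod_unfold using that w by (intro rungs_in_sg survive_in_sg) auto
  have Hx: "(1 - (1 - p) ^ (a + b + 1)) * x \<le> prob (H (a, b) i)" if "i < m" for a b i
    unfolding H_def case_prod_unfold fst_conv snd_conv
    using that w IH \<open>0 \<le> x\<close> by (intro prob_some_rung survive_in_sg) auto
  have sub: "(\<Union>i<m. branch m (i # w)) \<subseteq> bonds m" "range (Line w) \<subseteq> bonds m"
    using below_subset_bonds[OF w] by (auto simp: below_def)
  have disj: "range (Line w) \<inter> (\<Union>i<m. branch m (i # w)) = {}"
    using Line_notin_branch by blast
  have each: "p ^ (a + b) * (1 - p)\<^sup>2 * (1 - (1 - (1 - (1 - p) ^ (a + b + 1)) * x) ^ m)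
      \<le> prob (run w k a b \<inter> (\<Union>i<m. H (a, b) i))" for a b
  proof -
    have "prob (run w k a b \<inter> (\<Union>i<m. H (a, b) i)) = prob (run w k a b) * prob (\<Union>i<m. H (a, b) i)"
      by (rule prob_Int_sg[OF run_in_sg[OF w] children_in_sg[OF w Hsg] disj sub(2,1)])
    moreover have "1 - (1 - (1 - (1 - p) ^ (a + b + 1)) * x) ^ m \<le> prob (\<Union>i<m. H (a, b) i)"
      using w Hsg Hx by (intro prob_some_child) auto
    ultimately show ?thesis
      using p_bounds by (simp only: prob_run[OF w]) (intro mult_left_mono; simp)
  qed
  have ev: "run w k a b \<inter> (\<Union>i<m. H (a, b) i) \<in> events" for a b
    using run_in_sg[OF w] children_in_sg[OF w, of "H (a, b)"] Hsg sub sg_subset_events by blast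
  have "prob (survive (Suc n) w k) =
      prob (\<Union>ab\<in>{..<r} \<times> {..<r}. run w k (fst ab) (snd ab) \<inter> (\<Union>i<m. H ab i))"
    by (simp add: H_def case_prod_unfold)
  \<comment> \<open>Different runs exclude each other, so the probabilities add up.\<close>
  also have "\<dots> = (\<Sum>ab\<in>{..<r} \<times> {..<r}. prob (run w k (fst ab) (snd ab) \<inter> (\<Union>i<m. H ab i)))"
  proof (rule finite_measure_finite_Union)
    show "disjoint_family_on (\<lambda>ab. run w k (fst ab) (snd ab) \<inter> (\<Union>i<m. H ab i)) ({..<r} \<times> {..<r})"
      using run_unique by (fastforce simp: disjoint_family_on_def)
  qed (use ev in auto)
  also have "\<dots> \<ge> (\<Sum>ab\<in>{..<r} \<times> {..<r}. p ^ (fst ab + snd ab) * (1 - p)\<^sup>2 *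
      (1 - (1 - (1 - (1 - p) ^ (fst ab + snd ab + 1)) * x) ^ m))"
    using each[of "fst ab" "snd ab" for ab] by (intro sum_mono) (simp only: prod.collapse)
  finally show ?thesis by (simp add: case_prod_unfold)
qed

lemma survive_Suc_subset: "w \<in> lists {..<m} \<Longrightarrow> survive (Suc n) w k \<subseteq> survive n w k"
proof (induction n arbitrary: w k)
  case 0
  have "run w k a b \<subseteq> space M" for a b by (auto simp: run_def pattern_def)
  then show ?case by (simp add: UN_subset_iff le_infI1)
next
  case (Suc n)
  have *: "survive (Suc n) (i # w) j \<subseteq> survive n (i # w) j" if "i \<in> {..<m}" for i j
    using Suc.prems that by (intro Suc.IH) auto
  show ?case
    unfolding survive.simps(2)[of "Suc n" w k] survive.simps(2)[of n w k] case_prod_unfold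
    by (intro UN_mono Int_mono subset_refl *)
qed

end

subsection \<open>Open paths\<close>

lemma reachable_sym: "reachable G u v \<Longrightarrow> reachable G v u"
proof -
  have "sym {(x, y). {x, y} \<in> edges G}" by (auto simp: sym_def insert_commute)
  then show "reachable G u v \<Longrightarrow> reachable G v u"
    unfolding reachable_def by (metis sym_rtrancl symE)
qed

lemma reachable_trans: "reachable G u v \<Longrightarrow> reachable G v w \<Longrightarrow> reachable G u w"
  unfolding reachable_def by (rule rtrancl_trans)

lemma reachable_edge: "{u, v} \<in> edges G \<Longrightarrow> reachable G u v"
  unfolding reachable_def by (intro r_into_rtrancl) simp

lemma reachable_int_line:
  fixes k l :: int
  assumes "k \<le> l" "\<And>j. k \<le> j \<Longrightarrow> j < l \<Longrightarrow> {(u, j), (u, j + 1)} \<in> edges G"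
  shows "reachable G (u, k) (u, l)"
  using assms
proof (induction l rule: int_ge_induct)
  case base
  show ?case by (simp add: reachable_def)
next
  case (step l)
  then have "reachable G (u, k) (u, l)" "reachable G (u, l) (u, l + 1)"
    by (auto intro: reachable_edge)
  then show ?case by (rule reachable_trans)
qed

definition bond_edge :: "(nat list \<Rightarrow> 'a) \<Rightarrow> bond \<Rightarrow> ('a \<times> int) set" where
  "bond_edge v b = (case b of
     Line w k \<Rightarrow> {(v w, k), (v w, k + 1)}
   | Rung w k \<Rightarrow> {(v (tl w), k), (v w, k)})"

text \<open>A line edge changes the height and a rung edge keeps it, so the two kinds cannot
  coincide. Two rungs with the same edge but swapped ends would make each word the tail of the
  other, which is impossible for nonempty words.\<close>

lemma inj_on_bond_edge:
  assumes inj: "inj_on v (lists {..<m})"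
  shows "inj_on (bond_edge v) (bonds m)"
proof (rule inj_onI)
  have *: "w = w'" if "w \<in> lists {..<m}" "w' \<in> lists {..<m}" "v w = v w'" for w w'
    using inj_onD[OF inj] that by blast
  have tl: "tl w \<in> lists {..<m}" if "w \<in> lists {..<m}" for w
    using that by (cases w) auto
  fix b b' assume bb: "b \<in> bonds m" "b' \<in> bonds m" "bond_edge v b = bond_edge v b'"
  show "b = b'"
  proof (cases b; cases b')
    fix w k w' k' assume "b = Line w k" "b' = Line w' k'"
    then show ?thesis using bb *[of w w'] by (auto simp: bond_edge_def bonds_def doubleton_eq_iff)
  next
    fix w k w' k' assume "b = Line w k" "b' = Rung w' k'"
    then show ?thesis using bb by (auto simp: bond_edge_def doubleton_eq_iff)
  next
    fix w k w' k' assume "b = Rung w k" "b' = Line w' k'"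
    then show ?thesis using bb by (auto simp: bond_edge_def doubleton_eq_iff)
  next
    fix w k w' k' assume b: "b = Rung w k" "b' = Rung w' k'"
    then have w: "w \<in> lists {..<m}" "w' \<in> lists {..<m}" "w \<noteq> []" "w' \<noteq> []"
      using bb by (auto simp: bonds_def)
    have "k = k' \<and> (v w = v w' \<or> v (tl w) = v w' \<and> v w = v (tl w'))"
      using bb(3) by (auto simp: b bond_edge_def doubleton_eq_iff)
    moreover have "\<not> (tl w = w' \<and> w = tl w')"
      using w by (cases w; cases w') auto
    ultimately show ?thesis using b *[OF w(1,2)] *[OF tl[OF w(1)] w(2)] *[OF w(1) tl[OF w(2)]]
      by blast
  qed
qed

subsection \<open>Survival\<close>

context bond_events
begin

text \<open>\<open>growth\<close> says that \<open>x\<close> is at most its image under the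
  one-generation bound, so the lower bound \<open>x\<close> carries over from each generation to the
  next.\<close>

lemma prob_survive:
  assumes "w \<in> lists {..<m}" "0 \<le> x" "x \<le> 1"
    and growth: "x \<le> (\<Sum>(a, b)\<in>{..<r} \<times> {..<r}. p ^ (a + b) * (1 - p)\<^sup>2 *
      (1 - (1 - (1 - (1 - p) ^ (a + b + 1)) * x) ^ m))"
  shows "x \<le> prob (survive n w k)"
  using assms(1)
proof (induction n arbitrary: w k)
  case 0
  show ?case using \<open>x \<le> 1\<close> by (simp add: prob_space)
next
  case (Suc n)
  note growth
  also have "(\<Sum>(a, b)\<in>{..<r} \<times> {..<r}. p ^ (a + b) * (1 - p)\<^sup>2 *
      (1 - (1 - (1 - (1 - p) ^ (a + b + 1)) * x) ^ m)) \<le> prob (survive (Suc n) w k)"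
    using Suc by (intro prob_survive_Suc \<open>0 \<le> x\<close>) auto
  finally show ?case .
qed

section \<open>Survival for ever\<close>

lemma survive_INT_in_sg:
  assumes "w \<in> lists {..<m}"
  shows "(\<Inter>n. survive n w k) \<in> sg (below m w)"
proof -
  interpret S: sigma_algebra "space M" "sg (below m w)"
    using assms by (intro sigma_algebra_sg below_subset_bonds)
  show ?thesis using survive_in_sg[OF assms] by (intro S.countable_INT) auto
qed

text \<open>Continuity from above along the decreasing events \<open>survive n w k\<close>.\<close>

lemma prob_survive_INT:
  assumes w: "w \<in> lists {..<m}" and x: "\<And>n. x \<le> prob (survive n w k)"
  shows "x \<le> prob (\<Inter>n. survive n w k)"
proof -
  have "range (\<lambda>n. survive n w k) \<subseteq> events"
    using survive_in_sg[OF w] below_subset_bonds[OF w] sg_subset_events by blast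
  moreover have "decseq (\<lambda>n. survive n w k)"
    using survive_Suc_subset[OF w] by (intro decseq_SucI)
  ultimately have "(\<lambda>n. prob (survive n w k)) \<longlonglongrightarrow> prob (\<Inter>n. survive n w k)"
    by (rule finite_Lim_measure_decseq)
  then show ?thesis using x by (intro LIMSEQ_le_const) auto
qed

text \<open>\<open>extinct t w\<close> says that, of the explorations started at height 0 over the
  \<open>m ^ t\<close> descendants of \<open>w\<close> that lie \<open>t\<close> generations
  further, none survives for ever.\<close>

primrec extinct :: "nat \<Rightarrow> nat list \<Rightarrow> 'w set" where
  "extinct 0 w = space M - (\<Inter>n. survive n w 0)"
| "extinct (Suc t) w = (\<Inter>i<m. extinct t (i # w))"

lemma extinct_in_sg: "w \<in> lists {..<m} \<Longrightarrow> extinct t w \<in> sg (below m w)"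
proof (induction t arbitrary: w)
  case 0
  then interpret S: sigma_algebra "space M" "sg (below m w)"
    by (intro sigma_algebra_sg below_subset_bonds)
  show ?case using survive_INT_in_sg[OF 0] by auto
next
  case (Suc t)
  then interpret S: sigma_algebra "space M" "sg (below m w)"
    by (intro sigma_algebra_sg below_subset_bonds)
  have "extinct t (i # w) \<in> sg (below m w)" if "i < m" for i
  proof (rule sg_mono)
    show "extinct t (i # w) \<in> sg (below m (i # w))" using Suc that by auto
    show "below m (i # w) \<subseteq> below m w"
      using below_subset_branch[of m "i # w"] that by (auto simp: below_def[of m w])
  qed
  then show ?case using m_pos by (auto intro!: S.finite_INT)
qed

text \<open>Independence of sibling branches turns each generation into an \<open>m\<close>-fold
  product, whence the exponent \<open>m ^ t\<close>.\<close>

lemma prob_extinct: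
  assumes x: "\<And>n w. w \<in> lists {..<m} \<Longrightarrow> x \<le> prob (survive n w 0)"
  shows "w \<in> lists {..<m} \<Longrightarrow> prob (extinct t w) \<le> (1 - x) ^ (m ^ t)"
proof (induction t arbitrary: w)
  case 0
  have "(\<Inter>n. survive n w 0) \<in> events"
    using survive_INT_in_sg[OF 0] below_subset_bonds[OF 0] sg_subset_events by blast
  then show ?case using prob_survive_INT[OF 0 x[OF 0]] by (simp add: prob_compl)
next
  case (Suc t)
  have sub: "branch m (i # w) \<subseteq> bonds m" if "i < m" for i
    using that Suc.prems by (intro branch_subset_bonds) auto
  have "indep_sets (\<lambda>i. sg (branch m (i # w))) {..<m}"
    using sub branch_Cons_eqD by (intro indep_sets_sg) (auto simp: disjoint_family_on_def)
  moreover have "\<forall>i\<in>{..<m}. extinct t (i # w) \<in> sg (branch m (i # w))"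
    using Suc.prems by (auto intro!: sg_mono[OF extinct_in_sg below_subset_branch])
  ultimately have "prob (extinct (Suc t) w) = (\<Prod>i<m. prob (extinct t (i # w)))"
    using m_pos unfolding extinct.simps by (intro indep_setsD) auto
  also have "\<dots> \<le> (\<Prod>i<m. (1 - x) ^ (m ^ t))"
    using Suc by (intro prod_mono) auto
  also have "\<dots> = (1 - x) ^ (m ^ Suc t)"
    by (simp flip: power_mult add: mult.commute)
  finally show ?case .
qed

text \<open>If no exploration survives, \<open>extinct t []\<close> occurs for every
  \<open>t\<close>; its probability is at most \<open>(1 - x) ^ (m ^ t)\<close>, which tends to 0
  because \<open>2 \<le> m\<close>. This gives probability one without a zero-one law.\<close>

lemma AE_survive:
  assumes x: "\<And>n w. w \<in> lists {..<m} \<Longrightarrow> x \<le> prob (survive n w 0)" and "0 < x" "2 \<le> m"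
  shows "AE \<omega> in M. \<exists>w\<in>lists {..<m}. \<forall>n. \<omega> \<in> survive n w 0"
proof (rule AE_I)
  let ?N = "\<Inter>t. extinct t []"
  have "x \<le> 1" using x[of "[]" 0] by (simp add: prob_space)
  have *: "\<omega> \<in> extinct t w"
    if "\<omega> \<in> space M" "\<not> (\<exists>w\<in>lists {..<m}. \<forall>n. \<omega> \<in> survive n w 0)" "w \<in> lists {..<m}" for \<omega> t w
    using that by (induction t arbitrary: w) auto
  then show "{\<omega> \<in> space M. \<not> (\<exists>w\<in>lists {..<m}. \<forall>n. \<omega> \<in> survive n w 0)} \<subseteq> ?N" by blast
  have ev: "extinct t [] \<in> events" for t
    using extinct_in_sg[of "[]" t] below_subset_bonds[of "[]" m] sg_subset_events by blast
  then show "?N \<in> events" by auto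
  have "prob ?N \<le> (1 - x) ^ (m ^ t)" for t
    using prob_extinct[OF x, of "[]" t] ev finite_measure_mono[of ?N "extinct t []"] by force
  moreover have "(\<lambda>t. (1 - x) ^ (m ^ t)) \<longlonglongrightarrow> 0"
  proof -
    have "strict_mono (\<lambda>t. m ^ t)" using \<open>2 \<le> m\<close> by (intro strict_monoI power_strict_increasing) auto
    then show ?thesis
      using LIMSEQ_subseq_LIMSEQ[OF LIMSEQ_power_zero[of "1 - x"], of "\<lambda>t. m ^ t"] \<open>0 < x\<close> \<open>x \<le> 1\<close>
      by (simp add: o_def)
  qed
  ultimately have "prob ?N \<le> 0" by (intro LIMSEQ_le_const) auto
  then show "emeasure M ?N = 0"
    by (simp add: emeasure_eq_measure measure_le_0_iff)
qed

text \<open>Deterministic for a fixed \<omega>: each generation contributes an open path along the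
  run to the height of an open rung, and then that rung to the child.\<close>

lemma survive_reachable:
  assumes open_edge: "\<And>b. b \<in> bonds m \<Longrightarrow> \<omega> \<in> X b \<Longrightarrow> bond_edge v b \<in> edges H"
  shows "w \<in> lists {..<m} \<Longrightarrow> \<omega> \<in> survive n w k \<Longrightarrow>
    \<exists>w'\<in>lists {..<m}. \<exists>j. length w' = length w + n \<and> reachable H (v w, k) (v w', j)"
proof (induction n arbitrary: w k)
  case 0
  then show ?case by (auto simp: reachable_def)
next
  case (Suc n)
  then obtain a b i t where run: "\<omega> \<in> run w k a b" and i: "i < m" and t: "t < a + b + 1"
    and rung: "\<omega> \<in> X (Rung (i # w) (k - int a + int t))"
    and rest: "\<omega> \<in> survive n (i # w) (k - int a + int t)"
    by auto
  define j where "j = k - int a + int t"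
  have line: "{(v w, l), (v w, l + 1)} \<in> edges H" if "k - int a \<le> l" "l < k + int b" for l
    using run open_edge[of "Line w l"] Suc.prems that
    by (auto simp: run_def pattern_def bond_edge_def bonds_def)
  have "reachable H (v w, k) (v w, j)"
  proof (cases "k \<le> j")
    case True
    then show ?thesis using t by (intro reachable_int_line line) (auto simp: j_def)
  next
    case False
    then show ?thesis using t by (intro reachable_sym[OF reachable_int_line] line) (auto simp: j_def)
  qed
  moreover have "reachable H (v w, j) (v (i # w), j)"
    using open_edge[OF _ rung] i Suc.prems
    by (intro reachable_edge) (auto simp: bond_edge_def bonds_def j_def)
  moreover obtain w' j' where "w' \<in> lists {..<m}" "length w' = length (i # w) + n"
    "reachable H (v (i # w), j) (v w', j')"
    using Suc.IH[of "i # w" j] rest Suc.prems i by (auto simp: j_def)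
  ultimately show ?case
    by (intro bexI[of _ w'] exI[of _ j']) (auto intro: reachable_trans)
qed

text \<open>The component meets words of every length from \<open>length w\<close> on, hence
  infinitely many words, and \<open>v\<close> maps them to different tree vertices.\<close>

lemma infinite_component:
  assumes "\<And>b. b \<in> bonds m \<Longrightarrow> \<omega> \<in> X b \<Longrightarrow> bond_edge v b \<in> edges H"
    and "inj_on v (lists {..<m})" and verts: "\<And>w j. w \<in> lists {..<m} \<Longrightarrow> (v w, j) \<in> verts H"
    and w: "w \<in> lists {..<m}" "\<And>n. \<omega> \<in> survive n w k"
  shows "\<exists>C\<in>components_of_graph H. infinite C"
proof
  let ?C = "{y \<in> verts H. reachable H (v w, k) y}"
  show "?C \<in> components_of_graph H" using verts w by (auto simp: components_of_graph_def)
  let ?S = "{w' \<in> lists {..<m}. v w' \<in> fst ` ?C}"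
  have "range (\<lambda>n. length w + n) \<subseteq> length ` ?S"
  proof
    fix l assume "l \<in> range (\<lambda>n. length w + n)"
    then obtain n where "l = length w + n" by blast
    with survive_reachable[OF assms(1) w(1) w(2)[of n]] obtain w' j where
      "w' \<in> lists {..<m}" "l = length w'" "reachable H (v w, k) (v w', j)" by force
    then show "l \<in> length ` ?S" using verts by force
  qed
  moreover have "infinite (range (\<lambda>n. length w + n))"
    by (intro range_inj_infinite) (auto simp: inj_def)
  ultimately have "infinite ?S" by (meson finite_imageI finite_subset)
  moreover have "inj_on v ?S" using assms(2) by (rule inj_on_subset) auto
  ultimately have "infinite (v ` ?S)" by (simp add: finite_image_iff)
  moreover have "v ` ?S \<subseteq> fst ` ?C" by auto
  ultimately show "infinite ?C" by (meson finite_imageI finite_subset)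
qed

end

subsection \<open>Supercriticality\<close>

text \<open>An upper counterpart of Bernoulli's inequality. The quadratic term is crude, but for
  small \<open>y\<close> the linear term decides.\<close>

lemma power_one_minus_le:
  fixes y :: real
  assumes "0 \<le> y" "y \<le> 1"
  shows "(1 - y) ^ m \<le> 1 - real m * y + (real m * y)\<^sup>2"
proof (induction m)
  case (Suc m)
  have "(1 - y) ^ Suc m \<le> (1 - y) * (1 - real m * y + (real m * y)\<^sup>2)"
    using Suc assms by (simp add: mult_left_mono)
  also have "\<dots> = 1 - real (Suc m) * y + (real (Suc m) * y)\<^sup>2
      - ((real m + 1) * y\<^sup>2 + y * (real m * y)\<^sup>2)"
    by (simp add: algebra_simps power2_eq_square)
  also have "\<dots> \<le> 1 - real (Suc m) * y + (real (Suc m) * y)\<^sup>2"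
  proof -
    have "0 \<le> (real m + 1) * y\<^sup>2 + y * (real m * y)\<^sup>2"
      using assms by (intro add_nonneg_nonneg mult_nonneg_nonneg) auto
    then show ?thesis by linarith
  qed
  finally show ?case .
qed simp

text \<open>Linearises one summand of the growth condition in \<open>x\<close>. Here
  \<open>c\<close> is the probability of a run and \<open>u\<close> that of entering a given child
  from it; the linear terms will sum to the mean offspring times \<open>x\<close>, with an error of
  order \<open>x\<^sup>2\<close>.\<close>

lemma weighted_power_one_minus_le:
  fixes c u x :: real
  assumes "0 \<le> u" "u \<le> 1" "0 \<le> x" "x \<le> 1" "0 \<le> c"
  shows "real m * (c * u) * x - (real m)\<^sup>2 * x\<^sup>2 * c \<le> c * (1 - (1 - u * x) ^ m)"
proof -
  have ux: "0 \<le> u * x" "u * x \<le> x" "u * x \<le> 1"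
    using assms mult_left_le_one_le[of x u] by auto
  have "(u * x)\<^sup>2 \<le> x\<^sup>2" using ux by (intro power_mono)
  then have "(real m * (u * x))\<^sup>2 \<le> (real m)\<^sup>2 * x\<^sup>2"
    unfolding power_mult_distrib[of "real m"] by (intro mult_left_mono) auto
  with power_one_minus_le[OF ux(1,3), of m]
  have "real m * (u * x) - (real m)\<^sup>2 * x\<^sup>2 \<le> 1 - (1 - u * x) ^ m" by linarith
  then have "c * (real m * (u * x) - (real m)\<^sup>2 * x\<^sup>2) \<le> c * (1 - (1 - u * x) ^ m)"
    using assms by (intro mult_left_mono)
  then show ?thesis by (simp add: algebra_simps)
qed

text \<open>With \<open>S = d\<^sup>2 - d + 1\<close> the mean equals
  \<open>1 + (d * (d - 2)\<^sup>2 - 2) / S\<^sup>2\<close>, and \<open>d * (d - 2)\<^sup>2\<close>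
  is at least 3.\<close>

lemma mean_offspring_gt_1:
  assumes "d \<ge> (3 :: real)" and "p = 1 / d"
  shows "(d - 1) * (1 - (1 - p) ^ 3 / (1 - p * (1 - p))\<^sup>2) > 1"
proof -
  define S where "S = d\<^sup>2 - d + 1"
  have "S = d * (d - 1) + 1" by (simp add: S_def power2_eq_square algebra_simps)
  then have S: "S > 0" using assms by (simp add: add_nonneg_pos)
  have q: "1 - p = (d - 1) / d" "1 - p * (1 - p) = S / d\<^sup>2"
    unfolding \<open>p = 1 / d\<close> using assms(1) by (simp_all add: S_def field_simps power2_eq_square)
  have "(1 - p) ^ 3 / (1 - p * (1 - p))\<^sup>2 = d * (d - 1) ^ 3 / S\<^sup>2"
  proof -
    have "(a / d) ^ 3 / (S / d\<^sup>2)\<^sup>2 = d * a ^ 3 / S\<^sup>2" for a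
      using assms(1) S by (simp add: field_simps power2_eq_square power3_eq_cube)
    then show ?thesis unfolding q(2) unfolding q(1) .
  qed
  then have "(d - 1) * (1 - (1 - p) ^ 3 / (1 - p * (1 - p))\<^sup>2) =
      (d - 1) * (S\<^sup>2 - d * (d - 1) ^ 3) / S\<^sup>2"
    using S by (simp add: diff_divide_distrib right_diff_distrib)
  also have "(d - 1) * (S\<^sup>2 - d * (d - 1) ^ 3) = S\<^sup>2 + (d * (d - 2)\<^sup>2 - 2)"
    unfolding S_def by algebra
  also have "(S\<^sup>2 + (d * (d - 2)\<^sup>2 - 2)) / S\<^sup>2 > 1"
  proof -
    have "3 * 1 \<le> d * (d - 2)\<^sup>2" using assms by (intro mult_mono) (auto simp: one_le_power)
    then show ?thesis using S by (simp add: field_simps)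
  qed
  finally show ?thesis .
qed

lemma sum_power_add:
  fixes c :: "'a :: comm_semiring_1"
  shows "(\<Sum>(a, b)\<in>{..<r} \<times> {..<r}. c ^ (a + b)) = (\<Sum>a<r. c ^ a)\<^sup>2"
  by (simp add: power2_eq_square sum_product sum.cartesian_product power_add)

text \<open>Writing \<open>q\<close> for \<open>1 - p\<close>, each summand is
  \<open>q\<^sup>2 * p ^ (a + b) - q ^ 3 * (p * q) ^ (a + b)\<close>, so both parts are squares of
  geometric sums; their limits are 1 and the mean of \<open>q\<close> to the power of the run
  size.\<close>

lemma mean_offspring_tendsto:
  assumes "0 < p" "p < (1::real)"
  shows "(\<lambda>r. \<Sum>(a, b)\<in>{..<r} \<times> {..<r}. p ^ (a + b) * (1 - p)\<^sup>2 * (1 - (1 - p) ^ (a + b + 1)))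
    \<longlonglongrightarrow> 1 - (1 - p) ^ 3 / (1 - p * (1 - p))\<^sup>2"
proof -
  have pq: "0 \<le> p * (1 - p)" "p * (1 - p) < 1"
    using assms mult_strict_mono[of p 1 "1 - p" 1] by auto
  have "(\<Sum>(a, b)\<in>{..<r} \<times> {..<r}. p ^ (a + b) * (1 - p)\<^sup>2 * (1 - (1 - p) ^ (a + b + 1))) =
      (1 - p)\<^sup>2 * (\<Sum>a<r. p ^ a)\<^sup>2 - (1 - p) ^ 3 * (\<Sum>a<r. (p * (1 - p)) ^ a)\<^sup>2" for r
  proof -
    have "p ^ n * (1 - p)\<^sup>2 * (1 - (1 - p) ^ (n + 1)) =
        (1 - p)\<^sup>2 * p ^ n - (1 - p) ^ 3 * (p * (1 - p)) ^ n" for n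
    proof -
      have "p ^ n * q\<^sup>2 * (1 - q ^ (n + 1)) = q\<^sup>2 * p ^ n - q ^ 3 * (p * q) ^ n" for q
        by (simp add: algebra_simps power_mult_distrib power2_eq_square power3_eq_cube)
      then show ?thesis .
    qed
    then show ?thesis
      unfolding sum_power_add[symmetric]
      by (simp only: sum_distrib_left sum_subtractf case_prod_unfold)
  qed
  moreover have "(\<lambda>r. (1 - p)\<^sup>2 * (\<Sum>a<r. p ^ a)\<^sup>2 - (1 - p) ^ 3 * (\<Sum>a<r. (p * (1 - p)) ^ a)\<^sup>2)
      \<longlonglongrightarrow> (1 - p)\<^sup>2 * (1 / (1 - p))\<^sup>2 - (1 - p) ^ 3 * (1 / (1 - p * (1 - p)))\<^sup>2"
    using geometric_sums[of p] geometric_sums[of "p * (1 - p)"] assms pq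
    by (intro tendsto_intros) (auto simp: sums_def)
  ultimately show ?thesis using assms by (simp add: power_divide)
qed

text \<open>First \<open>r\<close> is taken so large that the truncated mean \<mu> still exceeds 1,
  then \<open>x\<close> so small that the quadratic loss is covered by the gain
  \<open>(\<mu> - 1) * x\<close>.\<close>

lemma growth_fixed_point:
  assumes "d \<ge> (3 :: nat)" and p: "p = 1 / real d"
  obtains r x where "0 < x" "x \<le> 1"
    "x \<le> (\<Sum>(a, b)\<in>{..<r} \<times> {..<r}. p ^ (a + b) * (1 - p)\<^sup>2 *
      (1 - (1 - (1 - (1 - p) ^ (a + b + 1)) * x) ^ (d - 1)))"
proof -
  let ?m = "real (d - 1)"
  let ?c = "\<lambda>a b. p ^ (a + b) * (1 - p)\<^sup>2" and ?u = "\<lambda>a b. 1 - (1 - p) ^ (a + b + 1)"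
  have p01: "0 < p" "p < 1" using assms by auto
  have m: "?m = real d - 1" using assms by simp
  have "(\<lambda>r. ?m * (\<Sum>(a, b)\<in>{..<r} \<times> {..<r}. ?c a b * ?u a b)) \<longlonglongrightarrow>
      ?m * (1 - (1 - p) ^ 3 / (1 - p * (1 - p))\<^sup>2)"
    using p01 by (intro tendsto_intros mean_offspring_tendsto)
  moreover have "?m * (1 - (1 - p) ^ 3 / (1 - p * (1 - p))\<^sup>2) > 1"
    unfolding m using assms by (intro mean_offspring_gt_1) auto
  ultimately have "\<forall>\<^sub>F r in sequentially. ?m * (\<Sum>(a, b)\<in>{..<r} \<times> {..<r}. ?c a b * ?u a b) > 1"
    by (rule order_tendstoD(1))
  then obtain r where r: "?m * (\<Sum>(a, b)\<in>{..<r} \<times> {..<r}. ?c a b * ?u a b) > 1"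
    using eventually_happens'[OF sequentially_bot] by blast
  define \<mu> where "\<mu> = ?m * (\<Sum>(a, b)\<in>{..<r} \<times> {..<r}. ?c a b * ?u a b)"
  \<comment> \<open>The second bound is exactly what \<open>?m\<^sup>2 * x \<le> \<mu> - 1\<close>
    demands; the first keeps \<open>x\<close> a possible probability.\<close>
  define x where "x = min 1 ((\<mu> - 1) / ?m\<^sup>2)"
  have x: "0 < x" "x \<le> 1" using r assms by (auto simp: x_def \<mu>_def)
  have "?m\<^sup>2 * x \<le> \<mu> - 1"
  proof -
    have "?m\<^sup>2 * x \<le> ?m\<^sup>2 * ((\<mu> - 1) / ?m\<^sup>2)" by (intro mult_left_mono) (auto simp: x_def)
    then show ?thesis using assms by simp
  qed
  have u: "0 \<le> ?u a b" "?u a b \<le> 1" for a b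
    using p01 by (auto simp: power_le_one simp del: power_Suc)
  \<comment> \<open>The run probabilities sum to \<open>(1 - p ^ r)\<^sup>2\<close>, the deficit
    from 1 being the truncation.\<close>
  have c_sum: "(\<Sum>(a, b)\<in>{..<r} \<times> {..<r}. ?c a b) \<le> 1"
  proof -
    have "(\<Sum>(a, b)\<in>{..<r} \<times> {..<r}. ?c a b) = ((1 - p) * (\<Sum>a<r. p ^ a))\<^sup>2"
      unfolding power_mult_distrib sum_power_add[symmetric]
      by (simp only: sum_distrib_left case_prod_unfold mult.commute)
    also have "(1 - p) * (\<Sum>a<r. p ^ a) = 1 - p ^ r" by (rule one_diff_power_eq[symmetric])
    also have "(1 - p ^ r)\<^sup>2 \<le> 1" using p01 by (intro power_le_one) (auto simp: power_le_one)
    finally show ?thesis .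
  qed
  have each: "?m * (?c a b * ?u a b) * x - ?m\<^sup>2 * x\<^sup>2 * ?c a b \<le> ?c a b * (1 - (1 - ?u a b * x) ^ (d - 1))" for a b
    using u x p01 by (intro weighted_power_one_minus_le) auto
  have "x \<le> \<mu> * x - ?m\<^sup>2 * x\<^sup>2 * 1"
    using mult_right_mono[OF \<open>?m\<^sup>2 * x \<le> \<mu> - 1\<close>, of x] x
    by (simp add: algebra_simps power2_eq_square)
  also have "\<dots> \<le> \<mu> * x - ?m\<^sup>2 * x\<^sup>2 * (\<Sum>(a, b)\<in>{..<r} \<times> {..<r}. ?c a b)"
    using c_sum by (intro diff_left_mono mult_left_mono) auto
  also have "\<dots> = (\<Sum>(a, b)\<in>{..<r} \<times> {..<r}. ?m * (?c a b * ?u a b) * x - ?m\<^sup>2 * x\<^sup>2 * ?c a b)"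
    unfolding \<mu>_def by (simp only: sum_distrib_left sum_distrib_right sum_subtractf case_prod_unfold)
  also have "\<dots> \<le> (\<Sum>(a, b)\<in>{..<r} \<times> {..<r}. ?c a b * (1 - (1 - ?u a b * x) ^ (d - 1)))"
    unfolding case_prod_unfold by (intro sum_mono each)
  finally show thesis by (rule that[OF x])
qed

subsection \<open>Percolation on the product graph\<close>

lemma prob_space_bond_percolation: "prob_space (bond_percolation G p)"
  unfolding bond_percolation_def
  by (intro prob_space_PiM measure_pmf.prob_space_axioms)

text \<open>The finite-dimensional distribution from which both the probability and the independence
  of the bond events are read off.\<close>

lemma edge_set_open:
  assumes "finite J" "J \<subseteq> edges G" "0 \<le> p" "p \<le> 1"
  shows "measure (bond_percolation G p) {\<omega> \<in> space (bond_percolation G p). \<forall>e\<in>J. \<omega> e} = p ^ card J"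
proof -
  interpret product_prob_space "\<lambda>_. measure_pmf (bernoulli_pmf p)" "edges G"
    by (intro product_prob_spaceI measure_pmf.prob_space_axioms)
  have "emeasure (bond_percolation G p) {\<omega> \<in> space (bond_percolation G p). \<forall>e\<in>J. \<omega> e \<in> {True}} =
      (\<Prod>e\<in>J. emeasure (measure_pmf (bernoulli_pmf p)) {True})"
    unfolding bond_percolation_def using assms by (intro emeasure_PiM_Collect) auto
  also have "\<dots> = ennreal (p ^ card J)"
    using assms by (simp add: emeasure_pmf_single ennreal_power)
  finally show ?thesis
    using assms by (simp add: measure_def)
qed

lemma cartesian_product_edgeI:
  assumes "u \<in> verts G" "v \<in> verts G" "k \<in> verts H" "l \<in> verts H"
    "u = v \<and> {k, l} \<in> edges H \<or> {u, v} \<in> edges G \<and> k = l"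
  shows "{(u, k), (v, l)} \<in> edges (G \<box> H)"
  unfolding cartesian_product_def snd_conv mem_Collect_eq
  using assms by (intro exI[of _ u] exI[of _ k] exI[of _ v] exI[of _ l]) simp

theorem theorem1:
  fixes T :: "'a ugraph" and d :: nat
  assumes "d \<ge> 3" and "regular_tree d T"
  shows "critical_probability (T \<box> int_line) \<le> 1 / real d"
proof -
  let ?G = "T \<box> int_line" and ?p = "1 / real d" and ?m = "d - 1"
  let ?M = "bond_percolation ?G ?p"
  obtain v where v: "\<And>w. w \<in> lists {..<?m} \<Longrightarrow> v w \<in> verts T" and inj: "inj_on v (lists {..<?m})"
    and adj: "\<And>i w. i < ?m \<Longrightarrow> w \<in> lists {..<?m} \<Longrightarrow> {v w, v (i # w)} \<in> edges T"
    using regular_tree_word_embedding[OF assms(2)] assms(1) by auto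
  obtain r x where x: "0 < x" "x \<le> 1" "x \<le> (\<Sum>(a, b)\<in>{..<r} \<times> {..<r}. ?p ^ (a + b) * (1 - ?p)\<^sup>2 *
      (1 - (1 - (1 - (1 - ?p) ^ (a + b + 1)) * x) ^ (d - 1)))"
    using growth_fixed_point[OF assms(1) refl] by blast
  have edge: "bond_edge v b \<in> edges ?G" if b: "b \<in> bonds ?m" for b
  proof (cases b)
    case (Line w k)
    then have "v w \<in> verts T" using b v by (auto simp: bonds_def)
    then show ?thesis
      unfolding Line bond_edge_def bond.case
      by (intro cartesian_product_edgeI) (auto simp: int_line_def)
  next
    case (Rung c k)
    then obtain i w where c: "c = i # w" "i < ?m" "w \<in> lists {..<?m}"
      using b by (auto simp: bonds_def neq_Nil_conv in_lists_conv_set)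
    then show ?thesis
      unfolding Rung bond_edge_def bond.case
      by (intro cartesian_product_edgeI) (use v adj in \<open>auto simp: int_line_def\<close>)
  qed
  define X where "X b = {\<omega> \<in> space ?M. \<omega> (bond_edge v b)}" for b
  interpret prob_space ?M by (rule prob_space_bond_percolation)
  \<comment> \<open>Injectivity of \<open>bond_edge\<close> makes distinct bonds distinct edges, so
    the exponent is the number of bonds; this is the product formula that independence asks
    for.\<close>
  have prob_INT: "prob (\<Inter>b\<in>J. X b) = ?p ^ card J" if "J \<subseteq> bonds ?m" "finite J" "J \<noteq> {}" for J
  proof -
    have "(\<Inter>b\<in>J. X b) = {\<omega> \<in> space ?M. \<forall>e\<in>bond_edge v ` J. \<omega> e}"
      using that by (auto simp: X_def)
    moreover have "card (bond_edge v ` J) = card J"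
      using inj_on_subset[OF inj_on_bond_edge[OF inj] that(1)] by (rule card_image)
    ultimately show ?thesis
      using edge_set_open[of "bond_edge v ` J" ?G ?p] that edge assms(1) by auto
  qed
  have prob_X: "prob (X b) = ?p" if "b \<in> bonds ?m" for b
    using prob_INT[of "{b}"] that by simp
  have "X b \<in> events" if "b \<in> bonds ?m" for b
    unfolding X_def bond_percolation_def using edge[OF that]
    by (intro sets_Collect_single') auto
  then have "indep_events X (bonds ?m)"
    using prob_INT prob_X by (intro indep_eventsI) (auto simp: subset_iff)
  then interpret bond_events ?M ?m r ?p X
    using prob_X assms(1) by unfold_locales auto
  have "AE \<omega> in ?M. \<exists>w\<in>lists {..<?m}. \<forall>n. \<omega> \<in> survive n w 0"
    using x assms(1) by (intro AE_survive[OF prob_survive]) auto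
  then have "AE \<omega> in ?M. \<exists>C\<in>clusters ?G \<omega>. infinite C"
  proof (rule AE_mp, intro AE_I2 impI)
    fix \<omega> assume "\<exists>w\<in>lists {..<?m}. \<forall>n. \<omega> \<in> survive n w 0"
    then obtain w where w: "w \<in> lists {..<?m}" "\<And>n. \<omega> \<in> survive n w 0" by blast
    show "\<exists>C\<in>clusters ?G \<omega>. infinite C"
      unfolding clusters_def
      by (rule infinite_component[OF _ inj _ w])
         (use edge v in \<open>auto simp: X_def open_subgraph_def cartesian_product_def int_line_def\<close>)
  qed
  \<comment> \<open>There is percolation at \<open>1 / d\<close> itself, so this value belongs to
    the set whose infimum is the critical probability.\<close>
  then have "?p \<in> {p \<in> {0..1}. AE \<omega> in bond_percolation ?G p. \<exists>C\<in>clusters ?G \<omega>. infinite C}"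
    using assms(1) by auto
  then show ?thesis
    unfolding critical_probability_def by (intro cInf_lower bdd_belowI[of _ 0]) auto
qed

end
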